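(* For every odd integer $n\geqslant 3$, there are infinitely many integral trees of diameter $2n+1$.
   Context: A graph is integral if all eigenvalues of its adjacency matrix are integers. *)

theory Defs
  imports Main "Jordan_Normal_Form.Char_Poly"
begin

text \<open>A finite simple graph is represented as a pair (m, E): the vertex set is
  {0..<m} and E is a symmetric irreflexive set of ordered pairs of vertices
  (each undirected edge uv appears as both (u,v) and (v,u)).\<close>

type_synonym graph = "nat \<times> (nat \<times> nat) set"

definition simple_graph :: "graph \<Rightarrow> bool" where
  "simple_graph G = (case G of (m, E) \<Rightarrow>
      E \<subseteq> {0..<m} \<times> {0..<m} \<and> (\<forall>u v. (u, v) \<in> E \<longrightarrow> (v, u) \<in> E) \<and> (\<forall>u. (u, u) \<notin> E))"

definition walk :: "graph \<Rightarrow> nat list \<Rightarrow> bool" where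
  "walk G xs = (xs \<noteq> [] \<and> set xs \<subseteq> {0..<fst G} \<and>
      (\<forall>i. Suc i < length xs \<longrightarrow> (xs ! i, xs ! Suc i) \<in> snd G))"

definition connected_graph :: "graph \<Rightarrow> bool" where
  "connected_graph G = (\<forall>u v. u < fst G \<longrightarrow> v < fst G \<longrightarrow>
      (\<exists>xs. walk G xs \<and> hd xs = u \<and> last xs = v))"

definition is_cycle :: "graph \<Rightarrow> nat list \<Rightarrow> bool" where
  "is_cycle G xs = (walk G xs \<and> length xs \<ge> 3 \<and> distinct xs \<and> (last xs, hd xs) \<in> snd G)"

definition acyclic_graph :: "graph \<Rightarrow> bool" where
  "acyclic_graph G = (\<not> (\<exists>xs. is_cycle G xs))"

definition is_tree :: "graph \<Rightarrow> bool" where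
  "is_tree G = (simple_graph G \<and> fst G \<ge> 1 \<and> connected_graph G \<and> acyclic_graph G)"

definition graph_dist :: "graph \<Rightarrow> nat \<Rightarrow> nat \<Rightarrow> nat" where
  "graph_dist G u v = (LEAST k. \<exists>xs. walk G xs \<and> hd xs = u \<and> last xs = v \<and> length xs = Suc k)"

definition diameter :: "graph \<Rightarrow> nat" where
  "diameter G = Max {graph_dist G u v | u v. u < fst G \<and> v < fst G}"

definition adjacency_matrix :: "graph \<Rightarrow> complex mat" where
  "adjacency_matrix G = mat (fst G) (fst G) (\<lambda>(i, j). if (i, j) \<in> snd G then 1 else 0)"

definition integral_graph :: "graph \<Rightarrow> bool" where
  "integral_graph G = (\<forall>k. eigenvalue (adjacency_matrix G) k \<longrightarrow> k \<in> \<int>)"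

definition graph_iso :: "graph \<Rightarrow> graph \<Rightarrow> bool" where
  "graph_iso G H = (\<exists>f. bij_betw f {0..<fst G} {0..<fst H} \<and>
      (\<forall>u v. u < fst G \<longrightarrow> v < fst G \<longrightarrow> ((u, v) \<in> snd G \<longleftrightarrow> (f u, f v) \<in> snd H)))"

definition iso_rel :: "(graph \<times> graph) set" where
  "iso_rel = {(G, H). graph_iso G H}"

end

theory Submission
  imports Defs
begin

text \<open>For a rooted tree and a number \<open>l\<close>, let \<open>g = l - \<Sum> 1 / g(child)\<close>, the sum taken over
  the children of the root. An eigenvector \<open>x\<close> for \<open>l\<close> satisfies \<open>g x(root) = x(parent)\<close>
  at every subtree, so \<open>l\<close> is not an eigenvalue if no \<open>g\<close> vanishes, and two trees joined by an
  edge between their roots have no eigenvalue \<open>l\<close> if no \<open>g\<close> below the two roots vanishes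
  and the two values at the roots have product \<open>\<noteq> 1\<close>.

  Given \<open>a 1 < a 2 < \<dots>\<close>, let \<open>T a k\<close> have as branches those of \<open>T a (k - 2)\<close> and
  \<open>a k - a (k - 1)\<close> copies of \<open>T a (k - 1)\<close> (with \<open>a 0 = 0\<close>). Then
  \<open>g(T a k) g(T a (k - 1)) = l\<^sup>2 - a k\<close>, so squares \<open>a j\<close> keep every \<open>g\<close> nonzero
  for non-integral \<open>l\<close>.

  Take \<open>t\<^sup>2 + 1 = 2 r\<^sup>2\<close> with \<open>t\<close> large. One half of the tree is \<open>T a n\<close> with
  \<open>a n = 2 t\<^sup>2\<close> and \<open>a j\<close> an even square for \<open>j < n\<close>. The other half should be \<open>T b n\<close> with
  \<open>b = (2 r\<^sup>2, a 1, \<dots>, a (n - 1))\<close>, except that \<open>2 r\<^sup>2\<close> is not a square. However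
  \<open>2 r\<^sup>2\<close> is the average of the even squares \<open>(t - 1)\<^sup>2\<close> and \<open>(t + 1)\<^sup>2\<close>, and \<open>g(T b n)\<close> is
  affine in \<open>b 1\<close>, so it suffices to combine half of the branches for each of the two squares.
  The values at the two roots then have product \<open>(l\<^sup>2 - 2 t\<^sup>2) (l\<^sup>2 - 2 r\<^sup>2) / l\<^sup>2\<close>, which is \<open>1\<close>
  only if \<open>l\<^sup>2 = t\<^sup>2\<close> or \<open>l\<^sup>2 = (2 r)\<^sup>2\<close>.\<close>

section \<open>Rooted trees and their continued fractions\<close>

datatype rtree = Node (children: "rtree list")

text \<open>The \<open>g\<close> of the overview. Since \<open>1 / 0 = 0\<close>, its relation to
  eigenvectors is guaranteed only when no value below the root vanishes, which
  \<open>nonsingular\<close> serves to express.\<close>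

fun cfrac :: "complex \<Rightarrow> rtree \<Rightarrow> complex" where
  "cfrac l (Node ts) = l - (\<Sum>t\<leftarrow>ts. 1 / cfrac l t)"

fun nonsingular :: "complex \<Rightarrow> rtree \<Rightarrow> bool" where
  "nonsingular l (Node ts) \<longleftrightarrow> cfrac l (Node ts) \<noteq> 0 \<and> (\<forall>t \<in> set ts. nonsingular l t)"

text \<open>A vertex is addressed by the list of branch indices leading to it from the root.\<close>

primrec is_vertex :: "rtree \<Rightarrow> nat list \<Rightarrow> bool" where
  "is_vertex t [] \<longleftrightarrow> True"
| "is_vertex t (i # p) \<longleftrightarrow> i < length (children t) \<and> is_vertex (children t ! i) p"

primrec subtree_at :: "rtree \<Rightarrow> nat list \<Rightarrow> rtree" where
  "subtree_at t [] = t"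
| "subtree_at t (i # p) = subtree_at (children t ! i) p"

text \<open>The eigenvector equations for a subtree whose root has a parent with value \<^term>\<open>c\<close>.\<close>

definition local_eigen :: "complex \<Rightarrow> rtree \<Rightarrow> (nat list \<Rightarrow> complex) \<Rightarrow> complex \<Rightarrow> bool" where
  "local_eigen l t x c \<longleftrightarrow> (\<forall>p. is_vertex t p \<longrightarrow>
     l * x p = (if p = [] then c else x (butlast p))
       + (\<Sum>i<length (children (subtree_at t p)). x (p @ [i])))"

lemma local_eigen_child:
  assumes "local_eigen l t x c" "i < length (children t)"
  shows "local_eigen l (children t ! i) (\<lambda>p. x (i # p)) (x [])"
  unfolding local_eigen_def
proof (intro allI impI)
  fix p assume "is_vertex (children t ! i) p"
  then have "is_vertex t (i # p)" using assms(2) by simp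
  from assms(1)[unfolded local_eigen_def, rule_format, OF this]
  show "l * x (i # p) = (if p = [] then x [] else x (i # butlast p))
       + (\<Sum>j<length (children (subtree_at (children t ! i) p)). x (i # p @ [j]))"
    by (cases "p = []") auto
qed

lemma nonsingular_cfrac: "nonsingular l t \<Longrightarrow> cfrac l t \<noteq> 0"
  by (cases t) auto

lemma nonsingular_children: "nonsingular l t \<Longrightarrow> s \<in> set (children t) \<Longrightarrow> nonsingular l s"
  by (cases t) auto

text \<open>By induction each child value is \<open>x []\<close> divided by the child's
  \<open>cfrac\<close>; substituting these into the equation at the root gives the claim. The root's
  own \<open>cfrac\<close> is never divided by, so the lemma also applies at two joined roots, where
  it may be zero.\<close>

lemma cfrac_local_eigen:
  assumes "\<forall>s \<in> set (children t). nonsingular l s" "local_eigen l t x c"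
  shows "cfrac l t * x [] = c"
  using assms
proof (induction t arbitrary: x c)
  case (Node ts)
  have child: "x [i] = x [] * (1 / cfrac l (ts ! i))" if i: "i < length ts" for i
  proof -
    have mem: "ts ! i \<in> set ts" using i by simp
    have "\<forall>s \<in> set (children (ts ! i)). nonsingular l s"
      using Node.prems(1) mem nonsingular_children by auto
    then have "cfrac l (ts ! i) * x [i] = x []"
      using Node.IH[OF mem, of "\<lambda>p. x (i # p)" "x []"] local_eigen_child[OF Node.prems(2), of i] i
      by simp
    moreover have "cfrac l (ts ! i) \<noteq> 0"
      using Node.prems(1) mem nonsingular_cfrac by auto
    ultimately show ?thesis by (simp add: field_simps)
  qed
  have "l * x [] = c + (\<Sum>i<length ts. x [i])"
    using Node.prems(2)[unfolded local_eigen_def, rule_format, of "[]"] by simp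
  also have "(\<Sum>i<length ts. x [i]) = (\<Sum>i<length ts. x [] * (1 / cfrac l (ts ! i)))"
    using child by (intro sum.cong) auto
  also have "\<dots> = x [] * (\<Sum>t\<leftarrow>ts. 1 / cfrac l t)"
    by (simp add: sum_list_sum_nth sum_distrib_left atLeast0LessThan)
  finally show ?case by (simp add: algebra_simps)
qed

text \<open>With parent value 0, a nonzero \<open>cfrac\<close> forces 0 at the root, which is the
  parent of the next level; zeros thus propagate downwards.\<close>

lemma local_eigen_zero:
  assumes "nonsingular l t" "local_eigen l t x 0" "is_vertex t p"
  shows "x p = 0"
  using assms
proof (induction p arbitrary: t x)
  case Nil
  then show ?case
    using cfrac_local_eigen[of t l x 0] nonsingular_cfrac nonsingular_children by auto
next
  case (Cons i p)
  have "x [] = 0"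
    using cfrac_local_eigen[of t l x 0] nonsingular_cfrac nonsingular_children Cons.prems by auto
  then have "local_eigen l (children t ! i) (\<lambda>p. x (i # p)) 0"
    using local_eigen_child[OF Cons.prems(2), of i] Cons.prems(3) by auto
  moreover have "nonsingular l (children t ! i)"
    using nonsingular_children[OF Cons.prems(1)] Cons.prems(3) by auto
  ultimately show ?case using Cons.IH[of "children t ! i" "\<lambda>p. x (i # p)"] Cons.prems(3) by auto
qed

text \<open>Here \<^term>\<open>Node (s # ts)\<close> is read as the tree \<^term>\<open>s\<close> and the tree \<^term>\<open>Node ts\<close>
  with their roots joined by an edge.\<close>

lemma local_eigen_join_zero:
  assumes "\<forall>r \<in> set (children s). nonsingular l r" "\<forall>r \<in> set ts. nonsingular l r"
    and "cfrac l s * cfrac l (Node ts) \<noteq> 1"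
    and "local_eigen l (Node (s # ts)) x 0" "is_vertex (Node (s # ts)) p"
  shows "x p = 0"
proof -
  note L = assms(4)
  have child: "local_eigen l ((s # ts) ! i) (\<lambda>p. x (i # p)) (x [])" if "i < Suc (length ts)" for i
    using local_eigen_child[OF L, of i] that by simp
  have s: "cfrac l s * x [0] = x []"
    using cfrac_local_eigen[OF assms(1)] child[of 0] by simp
  have c: "x [Suc i] = x [] * (1 / cfrac l (ts ! i))" if i: "i < length ts" for i
  proof -
    have mem: "ts ! i \<in> set ts" using i by simp
    have ns: "nonsingular l (ts ! i)" using assms(2) mem by auto
    have "cfrac l (ts ! i) * x [Suc i] = x []"
      using cfrac_local_eigen[of "ts ! i" l] child[of "Suc i"] i nonsingular_children[OF ns]
      by auto
    then show ?thesis using nonsingular_cfrac[OF ns] by (simp add: field_simps)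
  qed
  have "l * x [] = (\<Sum>i<Suc (length ts). x [i])"
    using L[unfolded local_eigen_def, rule_format, of "[]"] by simp
  also have "\<dots> = x [0] + (\<Sum>i<length ts. x [Suc i])"
    by (rule sum.lessThan_Suc_shift)
  also have "(\<Sum>i<length ts. x [Suc i]) = (\<Sum>i<length ts. x [] * (1 / cfrac l (ts ! i)))"
    using c by (intro sum.cong) auto
  also have "\<dots> = x [] * (\<Sum>t\<leftarrow>ts. 1 / cfrac l t)"
    by (simp add: sum_list_sum_nth sum_distrib_left atLeast0LessThan)
  finally have u: "cfrac l (Node ts) * x [] = x [0]" by (simp add: algebra_simps)
  \<comment> \<open>\<open>s\<close> and \<open>u\<close> express the values at the two joined roots
    through each other; combining them multiplies \<open>x []\<close> by a factor other than
    1.\<close>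
  have "cfrac l s * cfrac l (Node ts) * x [] = x []"
    using s u by (simp only: mult.assoc)
  then have root: "x [] = 0" using assms(3) by (auto simp del: cfrac.simps)
  then have x0: "x [0] = 0" using u by simp
  show ?thesis
  proof (cases p)
    case Nil then show ?thesis using root by simp
  next
    case (Cons i q)
    have i: "i < Suc (length ts)" and q: "is_vertex ((s # ts) ! i) q" using assms(5) Cons by auto
    show ?thesis
    proof (cases i)
      case (Suc j)
      have "nonsingular l (ts ! j)" using assms(2) i Suc by auto
      moreover have "local_eigen l (ts ! j) (\<lambda>p. x (i # p)) 0" using child[OF i] Suc root by simp
      ultimately show ?thesis
        using local_eigen_zero[of l "ts ! j" "\<lambda>p. x (i # p)" q] q Suc Cons by simp
    next
      case 0
      show ?thesis
      proof (cases q)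
        case Nil then show ?thesis using x0 0 Cons by simp
      next
        \<comment> \<open>As \<open>cfrac l s\<close> may be zero, the propagation of zeros starts
          one level lower, in the branches of \<open>s\<close>, whose parent value is
          \<open>x [0] = 0\<close>.\<close>
        case q': (Cons j r)
        have j: "j < length (children s)" and r: "is_vertex (children s ! j) r"
          using q q' 0 by auto
        have "local_eigen l s (\<lambda>p. x (0 # p)) (x [])" using child[of 0] by simp
        from local_eigen_child[OF this j] have "local_eigen l (children s ! j) (\<lambda>p. x (0 # j # p)) 0"
          using x0 by simp
        moreover have "nonsingular l (children s ! j)" using assms(1) j by auto
        ultimately show ?thesis
          using local_eigen_zero[of l "children s ! j" "\<lambda>p. x (0 # j # p)" r] r q' 0 Cons by simp
      qed
    qed
  qed
qed

section \<open>The graph of a rooted tree\<close>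

abbreviation vertices :: "rtree \<Rightarrow> nat list set" where
  "vertices t \<equiv> {p. is_vertex t p}"

lemma is_vertex_append:
  "is_vertex t (p @ q) \<longleftrightarrow> is_vertex t p \<and> is_vertex (subtree_at t p) q"
  by (induction p arbitrary: t) auto

lemma is_vertex_butlast: "is_vertex t p \<Longrightarrow> is_vertex t (butlast p)"
  by (cases p rule: rev_cases) (auto simp: is_vertex_append)

lemma finite_vertices: "finite (vertices t)"
proof (induction t)
  case (Node ts)
  have "vertices (Node ts) \<subseteq> insert [] (\<Union>i<length ts. (#) i ` vertices (ts ! i))"
  proof
    fix p assume "p \<in> vertices (Node ts)"
    then show "p \<in> insert [] (\<Union>i<length ts. (#) i ` vertices (ts ! i))" by (cases p) auto
  qed
  moreover have "finite (insert [] (\<Union>i<length ts. (#) i ` vertices (ts ! i)))"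
    using Node.IH by auto
  ultimately show ?case by (rule finite_subset)
qed

text \<open>The nonemptiness conditions keep \<open>butlast [] = []\<close> from creating a loop at
  the root.\<close>

definition tree_adj :: "rtree \<Rightarrow> (nat list \<times> nat list) set" where
  "tree_adj t = {(p, q). is_vertex t p \<and> is_vertex t q \<and>
     (q \<noteq> [] \<and> p = butlast q \<or> p \<noteq> [] \<and> q = butlast p)}"

lemma tree_adj_neighbours:
  assumes "is_vertex t p"
  shows "{q. (p, q) \<in> tree_adj t} = (if p = [] then {} else {butlast p})
     \<union> (\<lambda>i. p @ [i]) ` {..<length (children (subtree_at t p))}" (is "?A = ?B")
proof
  show "?A \<subseteq> ?B"
  proof
    fix q assume "q \<in> ?A"
    then have q: "is_vertex t q" "q \<noteq> [] \<and> p = butlast q \<or> p \<noteq> [] \<and> q = butlast p"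
      by (auto simp: tree_adj_def)
    show "q \<in> ?B"
    proof (cases "p \<noteq> [] \<and> q = butlast p")
      case False
      then have "q = p @ [last q]" using q(2) by (metis append_butlast_last_id)
      moreover from this have "last q < length (children (subtree_at t p))"
        using q(1) is_vertex_append[of t p "[last q]"] by auto
      ultimately show ?thesis by blast
    qed auto
  qed
  show "?B \<subseteq> ?A"
    using assms is_vertex_butlast[OF assms] by (auto simp: tree_adj_def is_vertex_append)
qed

text \<open>Graphs live on an initial segment of the naturals, so addresses must be numbered; any
  bijection will do.\<close>

definition vertex_code :: "rtree \<Rightarrow> nat list \<Rightarrow> nat" where
  "vertex_code t = (SOME f. bij_betw f (vertices t) {0..<card (vertices t)})"

lemma bij_vertex_code: "bij_betw (vertex_code t) (vertices t) {0..<card (vertices t)}"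
  unfolding vertex_code_def
  using someI_ex[OF ex_bij_betw_finite_nat[OF finite_vertices]] .

definition tree_graph :: "rtree \<Rightarrow> graph" where
  "tree_graph t = (card (vertices t), map_prod (vertex_code t) (vertex_code t) ` tree_adj t)"

lemma fst_tree_graph [simp]: "fst (tree_graph t) = card (vertices t)"
  by (simp add: tree_graph_def)

lemma vertex_code_less: "is_vertex t p \<Longrightarrow> vertex_code t p < card (vertices t)"
  using bij_vertex_code[of t] unfolding bij_betw_def by auto

lemma vertex_code_inject:
  "is_vertex t p \<Longrightarrow> is_vertex t q \<Longrightarrow> vertex_code t p = vertex_code t q \<longleftrightarrow> p = q"
  using bij_vertex_code[of t] unfolding bij_betw_def inj_on_def by auto

lemma vertex_code_surj:
  assumes "u < card (vertices t)"
  obtains p where "is_vertex t p" "u = vertex_code t p"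
proof -
  have "u \<in> vertex_code t ` vertices t"
    using bij_vertex_code[of t] assms unfolding bij_betw_def by auto
  then show ?thesis using that by auto
qed

lemma edge_tree_graph_iff:
  assumes "is_vertex t p" "is_vertex t q"
  shows "(vertex_code t p, vertex_code t q) \<in> snd (tree_graph t) \<longleftrightarrow> (p, q) \<in> tree_adj t"
proof
  assume "(vertex_code t p, vertex_code t q) \<in> snd (tree_graph t)"
  then obtain p' q' where "(p', q') \<in> tree_adj t"
      "vertex_code t p = vertex_code t p'" "vertex_code t q = vertex_code t q'"
    by (auto simp: tree_graph_def)
  then show "(p, q) \<in> tree_adj t"
    using vertex_code_inject assms unfolding tree_adj_def by auto
qed (auto simp: tree_graph_def)

lemma edge_tree_graphE:
  assumes "(u, v) \<in> snd (tree_graph t)"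
  obtains p q where "u = vertex_code t p" "v = vertex_code t q" "(p, q) \<in> tree_adj t"
  using assms by (auto simp: tree_graph_def)

lemma tree_adj_sym: "(p, q) \<in> tree_adj t \<Longrightarrow> (q, p) \<in> tree_adj t"
  by (auto simp: tree_adj_def)

lemma tree_adj_vertex: "(p, q) \<in> tree_adj t \<Longrightarrow> is_vertex t p \<and> is_vertex t q"
  by (auto simp: tree_adj_def)

lemma tree_adj_irrefl: "(p, p) \<notin> tree_adj t"
proof
  assume "(p, p) \<in> tree_adj t"
  then have "p \<noteq> []" "p = butlast p" by (auto simp: tree_adj_def)
  then have "length p = length p - 1" by (metis length_butlast)
  then show False using \<open>p \<noteq> []\<close> by (cases "length p") auto
qed

lemma simple_tree_graph: "simple_graph (tree_graph t)"
proof -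
  have "snd (tree_graph t) \<subseteq> {0..<card (vertices t)} \<times> {0..<card (vertices t)}"
    by (auto elim!: edge_tree_graphE dest!: tree_adj_vertex simp: vertex_code_less)
  moreover have "(v, u) \<in> snd (tree_graph t)" if "(u, v) \<in> snd (tree_graph t)" for u v
    using that by (metis edge_tree_graphE edge_tree_graph_iff tree_adj_sym tree_adj_vertex)
  moreover have "(u, u) \<notin> snd (tree_graph t)" for u
    by (metis edge_tree_graphE vertex_code_inject tree_adj_irrefl tree_adj_vertex)
  ultimately show ?thesis
    unfolding simple_graph_def by (auto simp: case_prod_beta)
qed

text \<open>A deepest vertex \<open>P k\<close> of a cycle cannot have a child on it, so its
  predecessor and successor on the cycle are both its parent. They would coincide, which
  distinctness and length at least 3 forbid.\<close>

lemma acyclic_tree_graph: "acyclic_graph (tree_graph t)"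
  unfolding acyclic_graph_def
proof
  assume "\<exists>xs. is_cycle (tree_graph t) xs"
  then obtain xs where cyc: "is_cycle (tree_graph t) xs" by blast
  define m where "m = length xs"
  have m: "m \<ge> 3" and dist: "distinct xs" and verts: "set xs \<subseteq> {0..<card (vertices t)}"
    and walk: "\<And>i. Suc i < m \<Longrightarrow> (xs ! i, xs ! Suc i) \<in> snd (tree_graph t)"
    and wrap: "(last xs, hd xs) \<in> snd (tree_graph t)"
    using cyc by (auto simp: is_cycle_def walk_def m_def)
  define P where "P i = inv_into (vertices t) (vertex_code t) (xs ! i)" for i
  have xsP: "is_vertex t (P i) \<and> xs ! i = vertex_code t (P i)" if "i < m" for i
  proof -
    have "xs ! i < card (vertices t)" using verts that by (auto simp: m_def subset_iff)
    then have "xs ! i \<in> vertex_code t ` vertices t"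
      using bij_vertex_code[of t] unfolding bij_betw_def by auto
    then show ?thesis unfolding P_def
      using f_inv_into_f[of "xs ! i" "vertex_code t" "vertices t"]
        inv_into_into[of "xs ! i" "vertex_code t" "vertices t"] by auto
  qed
  have step: "(P i, P (Suc i mod m)) \<in> tree_adj t" if i: "i < m" for i
  proof -
    have "(xs ! i, xs ! (Suc i mod m)) \<in> snd (tree_graph t)"
    proof (cases "Suc i < m")
      case True then show ?thesis using walk by simp
    next
      case False
      then have "Suc i = m" using i by simp
      moreover have "xs \<noteq> []" using m m_def by auto
      ultimately show ?thesis
        using wrap by (metis diff_Suc_1 hd_conv_nth last_conv_nth m_def mod_self)
    qed
    moreover have "Suc i mod m < m" using m by simp
    ultimately show ?thesis using xsP[OF i] xsP[of "Suc i mod m"] edge_tree_graph_iff by metis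
  qed
  obtain k where k: "k < m" and max: "\<And>i. i < m \<Longrightarrow> length (P i) \<le> length (P k)"
  proof -
    have "finite ((\<lambda>i. length (P i)) ` {..<m})" "(\<lambda>i. length (P i)) ` {..<m} \<noteq> {}"
      using m by (auto simp: lessThan_empty_iff)
    from Max_in[OF this] obtain k where "k < m" "Max ((\<lambda>i. length (P i)) ` {..<m}) = length (P k)"
      by auto
    with that show ?thesis using Max_ge[OF \<open>finite ((\<lambda>i. length (P i)) ` {..<m})\<close>] by force
  qed
  have parent: "P j = butlast (P k)" if "(P k, P j) \<in> tree_adj t" "j < m" for j
  proof (rule ccontr)
    assume "P j \<noteq> butlast (P k)"
    then have "P j \<noteq> []" "P k = butlast (P j)" using that by (auto simp: tree_adj_def)
    then have "length (P k) < length (P j)" by (cases "P j") auto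
    then show False using max[OF that(2)] by simp
  qed
  define j where "j = (if k = 0 then m - 1 else k - 1)"
  have j: "j < m" "Suc j mod m = k" using k m by (auto simp: j_def)
  have "P (Suc k mod m) = butlast (P k)" using parent step[OF k] m by simp
  moreover have "P j = butlast (P k)" using parent step[OF j(1)] j tree_adj_sym by metis
  ultimately have "xs ! (Suc k mod m) = xs ! j"
    using xsP[OF j(1)] xsP[of "Suc k mod m"] m by simp
  then have "Suc k mod m = j"
    using nth_eq_iff_index_eq[OF dist, of "Suc k mod m" j, folded m_def] j(1)
      mod_less_divisor[of m "Suc k"] m by (meson less_le_trans zero_less_numeral)
  then show False using m k unfolding j_def
    by (cases "Suc k = m") (auto split: if_splits)
qed

text \<open>An eigenvector, reindexed by addresses, solves \<open>local_eigen\<close>: each matrix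
  row splits into the parent and the children. Parent value 0 stands for the missing parent of the
  root.\<close>

lemma integral_tree_graph:
  assumes "\<And>l x p. l \<notin> \<int> \<Longrightarrow> local_eigen l t x 0 \<Longrightarrow> is_vertex t p \<Longrightarrow> x p = 0"
  shows "integral_graph (tree_graph t)"
  unfolding integral_graph_def
proof (intro allI impI, rule ccontr)
  fix l
  assume ev: "eigenvalue (adjacency_matrix (tree_graph t)) l" and l: "l \<notin> \<int>"
  define A where "A = adjacency_matrix (tree_graph t)"
  define N where "N = card (vertices t)"
  have A: "A \<in> carrier_mat N N" by (simp add: A_def N_def adjacency_matrix_def)
  obtain y where y: "y \<in> carrier_vec N" "y \<noteq> 0\<^sub>v N" "A *\<^sub>v y = l \<cdot>\<^sub>v y"
    using ev A unfolding eigenvalue_def eigenvector_def A_def[symmetric] by auto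
  define x where "x p = y $ vertex_code t p" for p
  have "local_eigen l t x 0"
    unfolding local_eigen_def
  proof (intro allI impI)
    fix p assume p: "is_vertex t p"
    let ?i = "vertex_code t p" and ?k = "length (children (subtree_at t p))"
    have i: "?i < N" using vertex_code_less[OF p] by (simp add: N_def)
    have "l * x p = (A *\<^sub>v y) $ ?i" using y i by (simp add: x_def)
    also have "\<dots> = (\<Sum>j\<in>{0..<N}. A $$ (?i, j) * y $ j)"
      using A y(1) i by (simp add: scalar_prod_def)
    also have "\<dots> = (\<Sum>j\<in>{0..<N}. (if (?i, j) \<in> snd (tree_graph t) then 1 else 0) * y $ j)"
      using i by (intro sum.cong) (auto simp: A_def adjacency_matrix_def N_def)
    also have "\<dots> = (\<Sum>q\<in>vertices t. (if (?i, vertex_code t q) \<in> snd (tree_graph t) then 1 else 0) * x q)"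
      unfolding N_def x_def
      by (rule sum.reindex_bij_betw[OF bij_vertex_code, symmetric])
    also have "\<dots> = (\<Sum>q\<in>vertices t. if (p, q) \<in> tree_adj t then x q else 0)"
      using edge_tree_graph_iff[OF p] by (intro sum.cong) auto
    also have "\<dots> = (\<Sum>q | (p, q) \<in> tree_adj t. x q)"
      by (intro sum.mono_neutral_cong_right finite_vertices) (auto dest: tree_adj_vertex)
    also have "\<dots> = (\<Sum>q \<in> (if p = [] then {} else {butlast p}). x q)
        + (\<Sum>q \<in> (\<lambda>i. p @ [i]) ` {..<?k}. x q)"
      unfolding tree_adj_neighbours[OF p]
    proof (rule sum.union_disjoint)
      show "(if p = [] then {} else {butlast p}) \<inter> (\<lambda>i. p @ [i]) ` {..<?k} = {}"
      proof -
        have "length (butlast p) \<noteq> length (p @ [i])" for i by simp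
        then have "butlast p \<noteq> p @ [i]" for i by metis
        then show ?thesis by auto
      qed
    qed auto
    also have "(\<Sum>q \<in> (\<lambda>i. p @ [i]) ` {..<?k}. x q) = (\<Sum>i<?k. x (p @ [i]))"
      by (subst sum.reindex) (auto simp: inj_on_def)
    finally show "l * x p = (if p = [] then 0 else x (butlast p)) + (\<Sum>i<?k. x (p @ [i]))"
      by (simp split: if_splits)
  qed
  then have zero: "x p = 0" if "is_vertex t p" for p using assms[OF l] that by blast
  have "y = 0\<^sub>v N"
  proof (rule eq_vecI)
    fix i assume "i < dim_vec (0\<^sub>v N :: complex vec)"
    then have "i < card (vertices t)" by (simp add: N_def)
    then obtain p where "is_vertex t p" "i = vertex_code t p" by (rule vertex_code_surj)
    then show "y $ i = 0\<^sub>v N $ i"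
      using zero \<open>i < dim_vec (0\<^sub>v N :: complex vec)\<close> by (auto simp: x_def)
  qed (use y in auto)
  then show False using y by simp
qed

section \<open>Distances\<close>

text \<open>Relation powers make concatenating and reversing walks simple algebra. The bound on
  \<open>u\<close> covers \<open>k = 0\<close>, where the one-vertex walk must lie in the
  graph.\<close>

lemma walk_iff_relpow:
  assumes "snd G \<subseteq> {0..<fst G} \<times> {0..<fst G}" "u < fst G"
  shows "(\<exists>xs. walk G xs \<and> hd xs = u \<and> last xs = v \<and> length xs = Suc k) \<longleftrightarrow> (u, v) \<in> snd G ^^ k"
    (is "?L \<longleftrightarrow> ?R")
proof
  assume ?L
  then obtain xs where xs: "walk G xs" "hd xs = u" "last xs = v" "length xs = Suc k" by blast
  have "xs \<noteq> []" using xs(4) by auto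
  then have "xs ! 0 = u" "xs ! k = v" using xs by (auto simp: hd_conv_nth last_conv_nth)
  moreover have "\<forall>i<k. (xs ! i, xs ! Suc i) \<in> snd G" using xs by (auto simp: walk_def)
  ultimately show ?R unfolding relpow_fun_conv by blast
next
  assume ?R
  then obtain f where f: "f 0 = u" "f k = v" "\<And>i. i < k \<Longrightarrow> (f i, f (Suc i)) \<in> snd G"
    unfolding relpow_fun_conv by blast
  define xs where "xs = map f [0..<Suc k]"
  have "f i < fst G" if "i \<le> k" for i
  proof (cases i)
    case (Suc j)
    then have "(f j, f i) \<in> snd G" using f(3)[of j] that by simp
    then show ?thesis using assms(1) by auto
  qed (use f(1) assms(2) in simp)
  then have "walk G xs" using f(3)
    by (auto simp: walk_def xs_def simp del: upt_Suc)
  moreover have "hd xs = u" using f(1) unfolding xs_def by (subst upt_conv_Cons) auto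
  moreover have "last xs = v" "length xs = Suc k" using f(2) by (simp_all add: xs_def)
  ultimately show ?L by blast
qed

lemma relpow_tree_graph_iff:
  assumes "is_vertex t p" "is_vertex t q"
  shows "(vertex_code t p, vertex_code t q) \<in> snd (tree_graph t) ^^ k \<longleftrightarrow> (p, q) \<in> tree_adj t ^^ k"
  using assms(2)
proof (induction k arbitrary: q)
  case 0
  then show ?case using vertex_code_inject assms by auto
next
  case (Suc k)
  show ?case
  proof
    assume "(vertex_code t p, vertex_code t q) \<in> snd (tree_graph t) ^^ Suc k"
    then obtain w where w: "(vertex_code t p, w) \<in> snd (tree_graph t) ^^ k"
        "(w, vertex_code t q) \<in> snd (tree_graph t)" by auto
    obtain p' where "is_vertex t p'" "w = vertex_code t p'"
      using w(2) by (metis edge_tree_graphE tree_adj_vertex)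
    then show "(p, q) \<in> tree_adj t ^^ Suc k"
      using w Suc.IH Suc.prems edge_tree_graph_iff by auto
  next
    assume "(p, q) \<in> tree_adj t ^^ Suc k"
    then obtain p' where "(p, p') \<in> tree_adj t ^^ k" "(p', q) \<in> tree_adj t" by auto
    then show "(vertex_code t p, vertex_code t q) \<in> snd (tree_graph t) ^^ Suc k"
      using Suc.IH[of p'] tree_adj_vertex edge_tree_graph_iff by (meson relpow_Suc_I)
  qed
qed

lemma tree_graph_edges: "snd (tree_graph t) \<subseteq> {0..<fst (tree_graph t)} \<times> {0..<fst (tree_graph t)}"
  using simple_tree_graph[of t] unfolding simple_graph_def by (auto simp: case_prod_beta)

lemma graph_dist_tree_graph:
  assumes "is_vertex t p" "is_vertex t q"
  shows "graph_dist (tree_graph t) (vertex_code t p) (vertex_code t q) = (LEAST k. (p, q) \<in> tree_adj t ^^ k)"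
proof -
  have "vertex_code t p < fst (tree_graph t)" using vertex_code_less[OF assms(1)] by simp
  then show ?thesis
    unfolding graph_dist_def
    by (simp only: walk_iff_relpow[OF tree_graph_edges] relpow_tree_graph_iff[OF assms])
qed

lemma relpow_sym: "sym R \<Longrightarrow> (p, q) \<in> R ^^ k \<Longrightarrow> (q, p) \<in> R ^^ k"
proof (induction k arbitrary: q)
  case (Suc k)
  then obtain r where "(p, r) \<in> R ^^ k" "(r, q) \<in> R" by auto
  then show ?case using Suc.IH[OF Suc.prems(1)] Suc.prems(1) by (meson relpow_Suc_I2 symD)
qed simp

lemma sym_tree_adj: "sym (tree_adj t)"
  by (auto simp: sym_def tree_adj_sym)

lemma tree_adj_to_prefix:
  "is_vertex t (p @ q) \<Longrightarrow> (p @ q, p) \<in> tree_adj t ^^ length q"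
proof (induction q rule: rev_induct)
  case (snoc i q)
  have v: "is_vertex t (p @ q)" using snoc.prems is_vertex_append[of t "p @ q" "[i]"] by simp
  have "(p @ q @ [i], p @ q) \<in> tree_adj t"
    using snoc.prems v by (auto simp: tree_adj_def butlast_append)
  from relpow_Suc_I2[OF this snoc.IH[OF v]] show ?case by simp
qed simp

text \<open>Go up to \<open>p\<close>, then down. Any common prefix serves, so this bounds distances
  from above without finding the longest one.\<close>

lemma tree_adj_via_prefix:
  assumes "is_vertex t (p @ q)" "is_vertex t (p @ r)"
  shows "(p @ q, p @ r) \<in> tree_adj t ^^ (length q + length r)"
  unfolding relpow_add
  by (rule relcompI[OF tree_adj_to_prefix[OF assms(1)]
        relpow_sym[OF sym_tree_adj tree_adj_to_prefix[OF assms(2)]]])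

lemma connected_tree_graph: "connected_graph (tree_graph t)"
  unfolding connected_graph_def
proof (intro allI impI)
  fix u v assume uv: "u < fst (tree_graph t)" "v < fst (tree_graph t)"
  then obtain p q where "is_vertex t p" "u = vertex_code t p" "is_vertex t q" "v = vertex_code t q"
    by (metis fst_tree_graph vertex_code_surj)
  then have "(u, v) \<in> snd (tree_graph t) ^^ (length p + length q)"
    using tree_adj_via_prefix[of t "[]" p q] relpow_tree_graph_iff by simp
  then show "\<exists>xs. walk (tree_graph t) xs \<and> hd xs = u \<and> last xs = v"
    using walk_iff_relpow[OF tree_graph_edges uv(1)] by blast
qed

lemma is_tree_tree_graph: "is_tree (tree_graph t)"
proof -
  have "vertices t \<noteq> {}" by (auto intro: exI[of _ "[]"])
  then have "card (vertices t) \<ge> 1"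
    using finite_vertices[of t] by (simp add: Suc_le_eq card_gt_0_iff)
  then show ?thesis
    unfolding is_tree_def
    using simple_tree_graph connected_tree_graph acyclic_tree_graph by simp
qed

text \<open>For the lower bound, the signed distance from the root, positive exactly inside the
  branch \<^term>\<open>s\<close>, changes by at most one along each edge.\<close>

lemma diameter_join:
  assumes s_le: "\<And>p. is_vertex s p \<Longrightarrow> length p \<le> n"
    and ts_le: "\<And>p. is_vertex (Node ts) p \<Longrightarrow> length p \<le> n"
    and s_ex: "\<exists>p. is_vertex s p \<and> length p = n"
    and ts_ex: "\<exists>p. is_vertex (Node ts) p \<and> length p = n"
  shows "diameter (tree_graph (Node (s # ts))) = 2 * n + 1"
proof -
  let ?t = "Node (s # ts)"
  define D where "D p q = (LEAST k. (p, q) \<in> tree_adj ?t ^^ k)" for p q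
  have set_eq: "{graph_dist (tree_graph ?t) u v | u v. u < fst (tree_graph ?t) \<and> v < fst (tree_graph ?t)}
      = {D p q | p q. is_vertex ?t p \<and> is_vertex ?t q}" (is "?X = ?Y")
  proof (intro equalityI subsetI)
    fix d assume "d \<in> ?X"
    then obtain u v where uv: "d = graph_dist (tree_graph ?t) u v" "u < card (vertices ?t)" "v < card (vertices ?t)"
      by auto
    obtain p where "is_vertex ?t p" "u = vertex_code ?t p" using uv(2) by (rule vertex_code_surj)
    moreover obtain q where "is_vertex ?t q" "v = vertex_code ?t q" using uv(3) by (rule vertex_code_surj)
    ultimately show "d \<in> ?Y" using uv graph_dist_tree_graph[of ?t p q] unfolding D_def by blast
  next
    fix d assume "d \<in> ?Y"
    then obtain p q where "d = D p q" "is_vertex ?t p" "is_vertex ?t q" by blast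
    then show "d \<in> ?X"
      using graph_dist_tree_graph[of ?t p q] vertex_code_less[of ?t] unfolding D_def fst_tree_graph
      by (metis (mono_tags, lifting) mem_Collect_eq)
  qed
  have D_le: "D p q \<le> k" if "(p, q) \<in> tree_adj ?t ^^ k" for p q k
    unfolding D_def using that by (rule Least_le)
  have other: "length p \<le> n" if p: "is_vertex ?t p" "\<nexists>r. p = 0 # r" for p
  proof (cases p)
    case (Cons i r)
    then obtain j where "i = Suc j" using p(2) by (cases i) auto
    then show ?thesis using ts_le[of "j # r"] p Cons by auto
  qed simp
  have upper: "D p q \<le> 2 * n + 1" if pq: "is_vertex ?t p" "is_vertex ?t q" for p q
  proof -
    have sum: "D p q \<le> length p + length q"
      using D_le[OF tree_adj_via_prefix[of ?t "[]" p q]] pq by simp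
    have in_s: "length r \<le> n" if "is_vertex ?t (0 # r)" for r using s_le[of r] that by simp
    show ?thesis
    proof (cases "\<exists>r. p = 0 # r")
      case True
      then obtain r where r: "p = 0 # r" by blast
      show ?thesis
      proof (cases "\<exists>r'. q = 0 # r'")
        case True
        then obtain r' where r': "q = 0 # r'" by blast
        \<comment> \<open>Meeting at \<open>[0]\<close>, the root of \<open>s\<close>, instead of at
          \<open>[]\<close> saves two edges; \<open>sum\<close> alone would only give
          \<open>2 * n + 2\<close>.\<close>
        have "D p q \<le> length r + length r'"
          using D_le[OF tree_adj_via_prefix[of ?t "[0]" r r']] pq r r' by simp
        then show ?thesis using in_s[of r] in_s[of r'] pq r r' by simp
      next
        case False
        then show ?thesis using sum in_s[of r] other[OF pq(2)] pq r by auto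
      qed
    next
      case False
      then have "length p \<le> n" using other[OF pq(1)] by simp
      moreover have "length q \<le> n + 1"
        using other[OF pq(2)] in_s pq(2) by (cases "\<exists>r. q = 0 # r") auto
      ultimately show ?thesis using sum by simp
    qed
  qed
  define h :: "nat list \<Rightarrow> int" where
    "h p = (if p \<noteq> [] \<and> hd p = 0 then int (length p) else - int (length p))" for p
  have h_butlast: "\<bar>h p - h (butlast p)\<bar> \<le> 1" for p
  proof (cases p)
    case (Cons i r)
    then show ?thesis by (cases "r = []") (auto simp: h_def)
  qed (simp add: h_def)
  have h_adj: "\<bar>h p - h q\<bar> \<le> 1" if "(p, q) \<in> tree_adj ?t" for p q
    using that h_butlast[of p] h_butlast[of q] by (auto simp: tree_adj_def abs_minus_commute)
  have h_relpow: "\<bar>h p - h q\<bar> \<le> int k" if "(p, q) \<in> tree_adj ?t ^^ k" for p q k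
    using that
  proof (induction k arbitrary: q)
    case (Suc k)
    then obtain r where "(p, r) \<in> tree_adj ?t ^^ k" "(r, q) \<in> tree_adj ?t" by auto
    then show ?case using Suc.IH[of r] h_adj[of r q] by linarith
  qed simp
  obtain p where p: "is_vertex s p" "length p = n" using s_ex by blast
  obtain q where q: "is_vertex (Node ts) q" "length q = n" using ts_ex by blast
  \<comment> \<open>Putting \<open>s\<close> in front shifts the index of every branch of
    \<open>Node ts\<close> by one.\<close>
  define q' where "q' = (case q of [] \<Rightarrow> [] | i # r \<Rightarrow> Suc i # r)"
  have q': "is_vertex ?t q'" "h q' = - int n" using q by (auto simp: q'_def h_def split: list.splits)
  have p': "is_vertex ?t (0 # p)" "h (0 # p) = int n + 1" using p by (auto simp: h_def)
  have "(0 # p, q') \<in> tree_adj ?t ^^ D (0 # p) q'"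
    unfolding D_def
    using tree_adj_via_prefix[of ?t "[]" "0 # p" q'] p'(1) q'(1) by (metis LeastI append_Nil)
  from h_relpow[OF this] have "D (0 # p) q' \<ge> 2 * n + 1" using p' q' by simp
  with upper[OF p'(1) q'(1)] have "2 * n + 1 = D (0 # p) q'" by simp
  then have mem: "2 * n + 1 \<in> ?Y" using p' q' by blast
  have "?Y \<subseteq> {..2 * n + 1}" using upper by auto
  then have "finite ?Y" by (rule finite_subset) simp
  then have "Max ?Y = 2 * n + 1" using mem upper by (intro Max_eqI) auto
  then show ?thesis unfolding diameter_def set_eq .
qed

section \<open>Csikvari trees\<close>

text \<open>\<^term>\<open>Node (branches 1 a k)\<close> is the tree of Csikvari with squared eigenvalues
  among \<^term>\<open>0\<close>, \<^term>\<open>a 1\<close>, \dots, \<^term>\<open>a k\<close>; the divisor \<^term>\<open>d\<close> thins out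
  the branches at the root only.\<close>

fun branches :: "nat \<Rightarrow> (nat \<Rightarrow> nat) \<Rightarrow> nat \<Rightarrow> rtree list" where
  "branches d a 0 = []"
| "branches d a (Suc 0) = replicate (a 1 div d) (Node [])"
| "branches d a (Suc (Suc k)) =
     replicate ((a (Suc (Suc k)) - a (Suc k)) div d) (Node (branches 1 a (Suc k))) @ branches d a k"

text \<open>Divisibility passes to the differences, so every \<open>div\<close> is exact and all
  multiplicities at the root scale by \<open>1 / d\<close>. With \<open>d = 2\<close> this gives the
  half contributions to the averaged tree.\<close>

lemma sum_list_branches_div:
  fixes f :: "rtree \<Rightarrow> complex"
  assumes "\<And>j. 0 < j \<Longrightarrow> d dvd a j"
  shows "(\<Sum>t\<leftarrow>branches d a k. f t) = (\<Sum>t\<leftarrow>branches 1 a k. f t) / of_nat d"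
proof -
  have div: "of_nat (m div d) = (of_nat m / of_nat d :: complex)" if "d dvd m" for m d
    using that by (cases "d = 0") (auto elim!: dvdE)
  show ?thesis
    using assms
  proof (induction d a k rule: branches.induct)
    case (3 d a k)
    have "d dvd a (Suc (Suc k)) - a (Suc k)" using "3.prems" by (intro dvd_diff_nat) auto
    then show ?case using 3
      by (simp add: sum_list_replicate add_divide_distrib div)
  qed (simp_all add: sum_list_replicate div)
qed

text \<open>Writing \<open>g k\<close> for the value at level \<open>k\<close>, the definition of
  \<open>branches\<close> gives \<open>g (k + 1) = g (k - 1) - (a (k + 1) - a k) / g k\<close>.
  Multiplying by \<open>g k\<close>, nonzero by the previous identity, replaces \<open>a k\<close>
  by \<open>a (k + 1)\<close>.\<close>

lemma cfrac_branches:
  assumes "l \<noteq> 0" "mono a" "\<And>j. 0 < j \<Longrightarrow> j < k \<Longrightarrow> l\<^sup>2 \<noteq> of_nat (a j)" "0 < k"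
  shows "cfrac l (Node (branches 1 a k)) * cfrac l (Node (branches 1 a (k - 1))) = l\<^sup>2 - of_nat (a k)"
  using assms(4,3)
proof (induction k rule: nat_induct_non_zero)
  case 1
  then show ?case using assms(1) by (simp add: sum_list_replicate field_simps power2_eq_square)
next
  case (Suc k)
  have le: "a k \<le> a (Suc k)" using assms(2) by (simp add: monoD)
  have IH: "cfrac l (Node (branches 1 a k)) * cfrac l (Node (branches 1 a (k - 1))) = l\<^sup>2 - of_nat (a k)"
    using Suc.IH Suc.prems by simp
  then have nz: "cfrac l (Node (branches 1 a k)) \<noteq> 0"
    using Suc.prems[of k] Suc.hyps by auto
  obtain m where m: "k = Suc m" using Suc.hyps by (cases k) auto
  define G where "G = cfrac l (Node (branches 1 a k))"
  have "cfrac l (Node (branches 1 a (Suc k)))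
      = cfrac l (Node (branches 1 a (k - 1))) - (of_nat (a (Suc k)) - of_nat (a k)) / G"
    using le unfolding m G_def by (simp add: sum_list_replicate of_nat_diff)
  moreover have "G \<noteq> 0" and "G * cfrac l (Node (branches 1 a (k - 1))) = l\<^sup>2 - of_nat (a k)"
    using IH nz unfolding G_def by auto
  ultimately have "G * cfrac l (Node (branches 1 a (Suc k)))
      = l\<^sup>2 - of_nat (a k) - G * ((of_nat (a (Suc k)) - of_nat (a k)) / G)"
    by (simp only: right_diff_distrib[of G "cfrac l (Node (branches 1 a (k - 1)))"])
  also have "\<dots> = l\<^sup>2 - of_nat (a (Suc k))" using \<open>G \<noteq> 0\<close> by simp
  finally show ?case unfolding G_def[symmetric] diff_Suc_1 by (simp only: mult.commute)
qed

text \<open>Every branch is a tree of some level \<open>j < k\<close>; for \<open>j > 0\<close> its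
  value is a factor of the nonzero number \<open>l\<^sup>2 - a j\<close>, and at level 0 it is
  \<open>l\<close>. Since \<open>a k\<close> itself is unrestricted, the last entry may be the
  non-square \<open>2 * t\<^sup>2\<close>.\<close>

lemma nonsingular_branches:
  assumes "l \<noteq> 0" "mono a" "\<And>j. 0 < j \<Longrightarrow> j < k \<Longrightarrow> l\<^sup>2 \<noteq> of_nat (a j)" "t \<in> set (branches d a k)"
  shows "nonsingular l t"
  using assms
proof (induction d a k arbitrary: t rule: branches.induct)
  case (3 d a k)
  have "cfrac l (Node (branches 1 a (Suc k))) \<noteq> 0"
    using cfrac_branches[OF 3(3,4), of "Suc k"] 3(5)[of "Suc k"] 3(5) by auto
  then have "nonsingular l (Node (branches 1 a (Suc k)))"
    using 3(1)[OF 3(3,4)] 3(5) by simp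
  then show ?case using 3(2)[OF 3(3,4)] 3(5,6) by auto
qed (simp_all split: if_splits)

text \<open>With \<open>A\<close>, \<open>B\<close> as in the proof, consecutive products agree
  after the shift: \<open>B (j + 2) * B (j + 1) = A (j + 1) * A j\<close>. So the ratio
  \<open>B (j + 1) / A j\<close> inverts at each step and is the same at all even \<open>j\<close>,
  namely its value \<open>(l\<^sup>2 - b 1) / l\<^sup>2\<close> at 0. This is where odd
  \<open>n\<close> enters.\<close>

lemma cfrac_branches_shift:
  assumes "l \<noteq> 0" "mono a" "mono b" "\<And>j. 0 < j \<Longrightarrow> j \<le> 2 * m \<Longrightarrow> b (Suc j) = a j"
    and "\<And>j. 0 < j \<Longrightarrow> j \<le> 2 * m \<Longrightarrow> l\<^sup>2 \<noteq> of_nat (a j)" "l\<^sup>2 \<noteq> of_nat (b 1)"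
  shows "l\<^sup>2 * cfrac l (Node (branches 1 b (Suc (2 * m))))
    = (l\<^sup>2 - of_nat (b 1)) * cfrac l (Node (branches 1 a (2 * m)))"
  using assms(4,5)
proof (induction m)
  case 0
  then show ?case using assms(1) by (simp add: sum_list_replicate field_simps power2_eq_square)
next
  case (Suc m)
  define A B where "A k = cfrac l (Node (branches 1 a k))" 
    and "B k = cfrac l (Node (branches 1 b k))" for k
  let ?k = "2 * m"
  have b_ne: "l\<^sup>2 \<noteq> of_nat (b j)" if "0 < j" "j \<le> ?k + 3" for j
  proof (cases "j = 1")
    case False
    then show ?thesis using Suc.prems(1)[of "j - 1"] Suc.prems(2)[of "j - 1"] that by auto
  qed (use assms(6) in simp)
  have A: "A (Suc k) * A k = l\<^sup>2 - of_nat (a (Suc k))" if "k < ?k + 2" for k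
    using cfrac_branches[OF assms(1,2), of "Suc k"] Suc.prems(2) that unfolding A_def by simp
  have B: "B (Suc k) * B k = l\<^sup>2 - of_nat (b (Suc k))" if "k < ?k + 3" for k
    using cfrac_branches[OF assms(1,3), of "Suc k"] b_ne that unfolding B_def by simp
  have IH: "l\<^sup>2 * B (Suc ?k) = (l\<^sup>2 - of_nat (b 1)) * A ?k"
    using Suc.IH Suc.prems unfolding A_def B_def by simp
  have 1: "B (?k + 2) * B (?k + 1) = A (?k + 1) * A ?k"
    using A[of ?k] B[of "?k + 1"] Suc.prems(1)[of "?k + 1"] by simp
  have 2: "B (?k + 3) * B (?k + 2) = A (?k + 2) * A (?k + 1)"
    using A[of "?k + 1"] B[of "?k + 2"] Suc.prems(1)[of "?k + 2"] by (simp add: eval_nat_numeral)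
  have nz: "B (?k + 2) \<noteq> 0" "B (?k + 1) \<noteq> 0" "A (?k + 1) \<noteq> 0" "A ?k \<noteq> 0"
    using A[of ?k] B[of "?k + 1"] b_ne[of "?k + 2"] Suc.prems(2)[of "?k + 1"] by auto
  have "B (?k + 3) * A ?k = A (?k + 2) * B (?k + 1)"
  \<comment> \<open>Multiplying by the two nonzero middle values makes \<open>1\<close> and
    \<open>2\<close> applicable.\<close>
  proof -
    have "(B (?k + 3) * A ?k) * (B (?k + 2) * A (?k + 1)) = (A (?k + 2) * B (?k + 1)) * (B (?k + 2) * A (?k + 1))"
    proof -
      have "(B (?k + 3) * A ?k) * (B (?k + 2) * A (?k + 1)) = (B (?k + 3) * B (?k + 2)) * (A (?k + 1) * A ?k)"
        by (simp only: ac_simps)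
      also have "\<dots> = (A (?k + 2) * A (?k + 1)) * (B (?k + 2) * B (?k + 1))" by (simp only: 1 2)
      also have "\<dots> = (A (?k + 2) * B (?k + 1)) * (B (?k + 2) * A (?k + 1))" by (simp only: ac_simps)
      finally show ?thesis .
    qed
    then show ?thesis using nz by simp
  qed
  then have "(l\<^sup>2 * B (?k + 3)) * A ?k = (l\<^sup>2 * B (Suc ?k)) * A (?k + 2)"
    by (simp add: mult.assoc mult.commute)
  also have "\<dots> = ((l\<^sup>2 - of_nat (b 1)) * A (?k + 2)) * A ?k"
    unfolding IH by (simp only: ac_simps)
  finally have "(l\<^sup>2 * B (?k + 3)) * A ?k = ((l\<^sup>2 - of_nat (b 1)) * A (?k + 2)) * A ?k" .
  then have "l\<^sup>2 * B (?k + 3) = (l\<^sup>2 - of_nat (b 1)) * A (?k + 2)" using nz(4) by simp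
  then show ?case unfolding A_def B_def by (simp add: eval_nat_numeral)
qed

lemma length_vertex_branches:
  "is_vertex (Node (branches d a k)) p \<Longrightarrow> length p \<le> k"
proof (induction d a k arbitrary: p rule: branches.induct)
  case (2 d a)
  then show ?case by (cases p; cases "tl p") auto
next
  case (3 d a k)
  show ?case
  proof (cases p)
    case (Cons i q)
    let ?r = "(a (Suc (Suc k)) - a (Suc k)) div d"
    show ?thesis
    proof (cases "i < ?r")
      case True
      then show ?thesis using 3(1)[of q] 3(3) Cons by (simp add: nth_append)
    next
      case False
      then have "is_vertex (Node (branches d a k)) ((i - ?r) # q)"
        using 3(3) Cons by (auto simp: nth_append)
      from 3(2)[OF this] show ?thesis using Cons by simp
    qed
  qed simp
qed (case_tac p; auto)

text \<open>Strict growth makes the first branch at each level a tree of the level just below, so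
  always taking branch 0 descends \<open>k\<close> times.\<close>

lemma ex_vertex_branches:
  assumes "a 1 > 0" "\<And>j. 0 < j \<Longrightarrow> j < k \<Longrightarrow> a j < a (Suc j)"
  shows "\<exists>p. is_vertex (Node (branches 1 a k)) p \<and> length p = k"
  using assms(2)
proof (induction k)
  case (Suc k)
  then obtain p where p: "is_vertex (Node (branches 1 a k)) p" "length p = k" by auto
  have "branches 1 a (Suc k) \<noteq> [] \<and> hd (branches 1 a (Suc k)) = Node (branches 1 a k)"
    using assms(1) Suc.prems[of k] by (cases k) (auto simp: hd_append)
  then have "branches 1 a (Suc k) ! 0 = Node (branches 1 a k)" "branches 1 a (Suc k) \<noteq> []"
    by (metis hd_conv_nth, metis)
  then have "is_vertex (Node (branches 1 a (Suc k))) (0 # p)"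
    using p by simp
  then show ?case using p by (intro exI[of _ "0 # p"]) simp
qed (auto intro: exI[of _ "[]"])

section \<open>The integral trees\<close>

text \<open>The recursion multiplies \<open>t + r sqrt 2\<close> by the unit
  \<open>3 + 2 sqrt 2\<close> of norm 1, which preserves the norm -1.\<close>

lemma negative_pell_unbounded: "\<exists>t r. N \<le> t \<and> t\<^sup>2 + 1 = 2 * (r::nat)\<^sup>2"
proof (induction N)
  case 0
  show ?case by (intro exI[of _ 1]) simp
next
  case (Suc N)
  then obtain t r where tr: "N \<le> t" "t\<^sup>2 + 1 = 2 * r\<^sup>2" by blast
  then have "r > 0" by (cases r) auto
  moreover have "(3 * t + 4 * r)\<^sup>2 + 1 = 2 * (2 * t + 3 * r)\<^sup>2"
    using tr(2) by (simp add: power2_eq_square algebra_simps)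
  ultimately show ?case using tr(1)
    by (intro exI[of _ "3 * t + 4 * r"] exI[of _ "2 * t + 3 * r"]) simp
qed

lemma square_ne_of_nat_square: "l\<^sup>2 \<noteq> of_nat (m\<^sup>2)" if "l \<notin> \<int>" for l :: complex
proof
  assume "l\<^sup>2 = of_nat (m\<^sup>2)"
  then have "l = of_nat m \<or> l = - of_nat m" by (simp add: power2_eq_iff)
  then show False using that by auto
qed

text \<open>The bound \<open>t \<ge> 8 * n\<close> makes room for the squares
  \<open>a 1 < ... < a (n - 1)\<close> below \<open>2 * t\<^sup>2\<close>;
  \<open>t \<le> fst G\<close> turns unbounded \<open>t\<close> into unbounded order.\<close>

lemma integral_tree_of_pell_solution:
  fixes n t r :: nat
  assumes "odd n" "n \<ge> 3" "t \<ge> 8 * n" "t\<^sup>2 + 1 = 2 * r\<^sup>2"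
  obtains G where "is_tree G" "integral_graph G" "diameter G = 2 * n + 1" "t \<le> fst G"
proof -
  define a where "a j = (if j < n then (t + 1 + 2 * j)\<^sup>2 else 2 * t\<^sup>2)" for j
  \<comment> \<open>\<open>b\<close> and \<open>b'\<close> differ only at index 1, with values
    \<open>(t - 1)\<^sup>2\<close> and \<open>(t + 1)\<^sup>2\<close>; at indices 2 to
    \<open>n\<close> both are \<open>a\<close> shifted by one.\<close>
  define b where "b j = (if j \<le> 1 then (t - 1)\<^sup>2 else (t - 1 + 2 * j)\<^sup>2)" for j
  define b' where "b' j = (t - 1 + 2 * j)\<^sup>2" for j
  define s where "s = Node (branches 2 b n @ branches 2 b' n)"
  define T where "T = Node (s # branches 1 a n)"
  obtain m where m: "n = Suc (2 * m)" using assms(1) by (auto elim: oddE)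
  obtain k where k: "n = Suc (Suc k)"
    using assms(2) by (metis add_2_eq_Suc le_Suc_ex numeral_3_eq_3 add_Suc)
  have "t > 0" using assms by simp
  \<comment> \<open>Odd \<open>t\<close> makes all entries of \<open>b\<close> and \<open>b'\<close>
    even, so that halving the branches is exact.\<close>
  have "odd (t\<^sup>2)" using assms(4) by (metis dvd_triv_left even_plus_one_iff)
  then have "odd t" by simp
  have gap: "(t + 2 * n)\<^sup>2 + t \<le> 2 * t\<^sup>2"
  proof -
    \<comment> \<open>\<open>(5 / 4)\<^sup>2 = 25 / 16\<close> is less than 2, and for
      \<open>t \<ge> 24\<close> the remaining \<open>7 / 16\<close> of \<open>t\<^sup>2\<close>
      covers the summand \<open>t\<close>.\<close>
    have "4 * (t + 2 * n) \<le> 5 * t" using assms(3) by simp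
    then have "(4 * (t + 2 * n))\<^sup>2 \<le> (5 * t)\<^sup>2" by (rule power_mono) simp
    then have "16 * (t + 2 * n)\<^sup>2 \<le> 25 * t\<^sup>2" unfolding power_mult_distrib by simp
    moreover have "24 * t \<le> t\<^sup>2" unfolding power2_eq_square using assms(2,3)
      by (intro mult_right_mono) auto
    ultimately show ?thesis by linarith
  qed
  have a_less: "a j < a (Suc j)" if "j < n" for j
  proof (cases "Suc j < n")
    case True
    then show ?thesis using that by (simp add: a_def power_strict_mono)
  next
    case False
    have "(t + 1 + 2 * j)\<^sup>2 \<le> (t + 2 * n)\<^sup>2" using that by (intro power_mono) auto
    with gap \<open>t > 0\<close> have "(t + 1 + 2 * j)\<^sup>2 < 2 * t\<^sup>2" by linarith
    then show ?thesis using False that by (simp add: a_def)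
  qed
  have mono_a: "mono a"
    unfolding mono_iff_le_Suc
  proof
    fix j show "a j \<le> a (Suc j)"
      using a_less[of j] by (cases "j < n") (auto simp: a_def)
  qed
  have mono_b: "mono b" and mono_b': "mono b'"
    by (auto simp: mono_def b_def b'_def intro!: power_mono)
  have b'_less: "b' j < b' (Suc j)" for j by (simp add: b'_def power_strict_mono)
  have b_shift: "b (Suc j) = a j" "b' (Suc j) = a j" if "0 < j" "j \<le> 2 * m" for j
    using that \<open>t > 0\<close> m by (auto simp: a_def b_def b'_def intro!: arg_cong[of _ _ "\<lambda>x. x\<^sup>2"])
  have b_dvd: "2 dvd b j" "2 dvd b' j" for j using \<open>odd t\<close> by (auto simp: b_def b'_def)
  have len: "length (branches 1 a n) \<ge> t"
  proof -
    have "(t + 1 + 2 * (n - 1))\<^sup>2 \<le> (t + 2 * n)\<^sup>2" by (intro power_mono) (use assms(2) in auto)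
    with gap have "t \<le> 2 * t\<^sup>2 - (t + 1 + 2 * (n - 1))\<^sup>2" by linarith
    then have "t \<le> a n - a (n - 1)" using assms(2) by (simp add: a_def)
    then show ?thesis by (simp add: k)
  qed
  have "integral_graph (tree_graph T)"
  proof (rule integral_tree_graph)
    fix l x p
    assume l: "l \<notin> \<int>" and x: "local_eigen l T x 0" and p: "is_vertex T p"
    have l0: "l \<noteq> 0" using l by auto
    note ne = square_ne_of_nat_square[OF l]
    have ne_a: "l\<^sup>2 \<noteq> of_nat (a j)" if "j < n" for j using ne that unfolding a_def by presburger
    have ne_b: "l\<^sup>2 \<noteq> of_nat (b j)" "l\<^sup>2 \<noteq> of_nat (b' j)" for j using ne unfolding b_def b'_def by presburger+
    define A where "A k = cfrac l (Node (branches 1 a k))" for k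
    have u: "A n * A (2 * m) = l\<^sup>2 - of_nat (2 * t\<^sup>2)"
      using cfrac_branches[OF l0 mono_a, of n] ne_a m unfolding A_def by (simp add: a_def)
    have sum2: "(\<Sum>t\<leftarrow>branches 2 c n. 1 / cfrac l t) = (l - cfrac l (Node (branches 1 c n))) / 2"
      if "\<And>j. 2 dvd c j" for c
      using sum_list_branches_div[of 2 c "\<lambda>t. 1 / cfrac l t" n] that by simp
    have "cfrac l s = (cfrac l (Node (branches 1 b n)) + cfrac l (Node (branches 1 b' n))) / 2"
      unfolding s_def using sum2[of b] sum2[of b'] b_dvd by (simp add: field_simps)
    then have "2 * (l\<^sup>2 * cfrac l s) = l\<^sup>2 * cfrac l (Node (branches 1 b n)) + l\<^sup>2 * cfrac l (Node (branches 1 b' n))"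
      by (simp only: distrib_left[symmetric]) simp
    also have "\<dots> = (l\<^sup>2 - of_nat (b 1)) * A (2 * m) + (l\<^sup>2 - of_nat (b' 1)) * A (2 * m)"
      using cfrac_branches_shift[OF l0 mono_a mono_b, of m] cfrac_branches_shift[OF l0 mono_a mono_b', of m]
        b_shift ne_a ne_b m unfolding A_def by (simp del: cfrac.simps)
    also have "\<dots> = (2 * l\<^sup>2 - of_nat (b 1 + b' 1)) * A (2 * m)" by (simp add: algebra_simps)
    also have "b 1 + b' 1 = 2 * (2 * r\<^sup>2)"
    proof -
      \<comment> \<open>\<open>t = Suc w\<close> removes the truncated subtraction in
        \<open>(t - 1)\<^sup>2\<close>.\<close>
      obtain w where "t = Suc w" using \<open>t > 0\<close> by (cases t) auto
      then show ?thesis using assms(4) by (simp add: b_def b'_def power2_eq_square algebra_simps)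
    qed
    also have "(2 * l\<^sup>2 - of_nat (2 * (2 * r\<^sup>2))) * A (2 * m) = 2 * ((l\<^sup>2 - of_nat (2 * r\<^sup>2)) * A (2 * m))"
      by (simp add: algebra_simps)
    finally have v: "l\<^sup>2 * cfrac l s = (l\<^sup>2 - of_nat (2 * r\<^sup>2)) * A (2 * m)"
      by (simp only: mult_cancel_left) simp
    have "cfrac l s * A n \<noteq> 1"
    proof
      assume "cfrac l s * A n = 1"
      then have "l\<^sup>2 = l\<^sup>2 * (cfrac l s * A n)" by simp
      also have "\<dots> = (l\<^sup>2 * cfrac l s) * A n" by (simp only: mult.assoc)
      also have "\<dots> = (l\<^sup>2 - of_nat (2 * r\<^sup>2)) * (A n * A (2 * m))" unfolding v by (simp only: ac_simps)
      finally have eq: "l\<^sup>2 = (l\<^sup>2 - 2 * (of_nat r)\<^sup>2) * (l\<^sup>2 - 2 * (of_nat t)\<^sup>2)" unfolding u by simp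
      have pell: "(of_nat t)\<^sup>2 = 2 * (of_nat r :: complex)\<^sup>2 - 1"
        using arg_cong[OF assms(4), of "of_nat :: nat \<Rightarrow> complex"]
        by (simp add: eq_diff_eq add.commute)
      \<comment> \<open>As quadratics in \<open>l\<^sup>2\<close>, both sides have constant term
        \<open>4 * r\<^sup>2 * t\<^sup>2\<close>; the linear terms agree because \<open>t\<^sup>2 +
        4 * r\<^sup>2 = 2 * r\<^sup>2 + 2 * t\<^sup>2 + 1\<close>.\<close>
      have "(l\<^sup>2 - (of_nat t)\<^sup>2) * (l\<^sup>2 - 4 * (of_nat r)\<^sup>2)
          = (l\<^sup>2 - 2 * (of_nat r)\<^sup>2) * (l\<^sup>2 - 2 * (of_nat t)\<^sup>2) - l\<^sup>2"
        unfolding pell by (simp add: algebra_simps)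
      then have "(l\<^sup>2 - (of_nat t)\<^sup>2) * (l\<^sup>2 - 4 * (of_nat r)\<^sup>2) = 0"
        using eq by simp
      then have "l\<^sup>2 = of_nat (t\<^sup>2) \<or> l\<^sup>2 = of_nat ((2 * r)\<^sup>2)" by (auto simp: power_mult_distrib)
      then show False using ne by blast
    qed
    moreover have "\<forall>q \<in> set (children s). nonsingular l q"
      using nonsingular_branches[OF l0 mono_b] nonsingular_branches[OF l0 mono_b'] ne_b
      unfolding s_def by auto
    moreover have "\<forall>q \<in> set (branches 1 a n). nonsingular l q"
      using nonsingular_branches[OF l0 mono_a] ne_a by blast
    ultimately show "x p = 0"
      using local_eigen_join_zero x p unfolding T_def A_def by blast
  qed
  moreover have "diameter (tree_graph T) = 2 * n + 1"
    unfolding T_def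
  proof (rule diameter_join)
    show "length p \<le> n" if "is_vertex s p" for p
    proof (cases p)
      case (Cons i q)
      let ?k = "length (branches 2 b n)"
      have "is_vertex (Node (branches 2 b n)) p \<or> is_vertex (Node (branches 2 b' n)) ((i - ?k) # q)"
        using that Cons unfolding s_def by (auto simp: nth_append split: if_splits)
      then show ?thesis using length_vertex_branches Cons by fastforce
    qed simp
    show "\<exists>p. is_vertex s p \<and> length p = n"
    proof -
      have "b' 1 > 0" using \<open>t > 0\<close> by (simp add: b'_def)
      then obtain p where p: "is_vertex (Node (branches 1 b' (Suc k))) p" "length p = Suc k"
        using ex_vertex_branches[of b' "Suc k"] b'_less by blast
      let ?k = "length (branches 2 b n)"
      \<comment> \<open>This difference is even and positive, so halving it leaves at least one
        branch of level \<open>n - 1 = Suc k\<close>; the first such branch has index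
        \<open>?k\<close>.\<close>
      have "2 dvd b' n - b' (Suc k)" using b_dvd by (intro dvd_diff_nat)
      moreover have "b' n - b' (Suc k) > 0" using b'_less[of "Suc k"] k by simp
      ultimately have "(b' n - b' (Suc k)) div 2 > 0"
        using dvd_imp_le[of 2 "b' n - b' (Suc k)"] by (simp only: div_greater_zero_iff) simp
      then have "is_vertex s (?k # p)"
        using p(1) unfolding s_def by (simp add: nth_append k)
      then show ?thesis using p(2) k by (intro exI[of _ "?k # p"]) simp
    qed
    show "\<exists>p. is_vertex (Node (branches 1 a n)) p \<and> length p = n"
      using ex_vertex_branches[of a n] a_less order.strict_trans1[OF _ a_less[of 0]] assms(2) by simp
  qed (rule length_vertex_branches)
  moreover have "t \<le> card (vertices T)"
  proof -
    have "(\<lambda>i. [i]) ` {..<length (branches 1 a n)} \<subseteq> vertices T" by (auto simp: T_def)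
    from card_mono[OF finite_vertices this] have "length (branches 1 a n) \<le> card (vertices T)"
      by (simp add: card_image inj_on_def)
    then show ?thesis using len by simp
  qed
  ultimately show ?thesis using that[of "tree_graph T"] is_tree_tree_graph by simp
qed

text \<open>Isomorphic graphs have equally many vertices, so finitely many classes would allow only
  finitely many orders.\<close>

lemma infinite_iso_classes:
  assumes "\<And>N. \<exists>G \<in> S. N \<le> fst G"
  shows "infinite (S // iso_rel)"
proof
  assume fin: "finite (S // iso_rel)"
  have class_size: "fst ` (iso_rel `` {G}) = {fst G}" for G
  proof
    show "fst ` (iso_rel `` {G}) \<subseteq> {fst G}"
      by (auto simp: iso_rel_def graph_iso_def dest!: bij_betw_same_card)
    \<comment> \<open>Reflexivity makes the class of \<open>G\<close> nonempty, so its order can be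
      recovered from it.\<close>
    have "graph_iso G G" unfolding graph_iso_def by (intro exI[of _ id]) auto
    then show "{fst G} \<subseteq> fst ` (iso_rel `` {G})" by (auto simp: iso_rel_def)
  qed
  have "(\<lambda>G. {fst G}) ` S = (`) fst ` (S // iso_rel)"
    unfolding quotient_def by (auto simp: class_size image_UN)
  with fin have "finite ((\<lambda>G. {fst G}) ` S)" by simp
  then have "finite (the_elem ` (\<lambda>G. {fst G}) ` S)" by (rule finite_imageI)
  then have "finite (fst ` S)" by (simp add: image_image)
  then obtain N where N: "\<forall>m \<in> fst ` S. m < N"
    unfolding finite_nat_set_iff_bounded by blast
  obtain G where "G \<in> S" "N \<le> fst G" using assms by blast
  then show False using N by (metis image_eqI leD)
qed

theorem theorem6:
  fixes n :: nat
  assumes "odd n" and "n \<ge> 3"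
  shows "infinite ({G. is_tree G \<and> integral_graph G \<and> diameter G = 2 * n + 1} // iso_rel)"
proof (rule infinite_iso_classes)
  fix N
  obtain t r where "max N (8 * n) \<le> t" "t\<^sup>2 + 1 = 2 * r\<^sup>2"
    using negative_pell_unbounded by blast
  then obtain G where "is_tree G" "integral_graph G" "diameter G = 2 * n + 1" "t \<le> fst G"
    using integral_tree_of_pell_solution[OF assms, of t r] by (metis max.bounded_iff)
  then show "\<exists>G \<in> {G. is_tree G \<and> integral_graph G \<and> diameter G = 2 * n + 1}. N \<le> fst G"
    using \<open>max N (8 * n) \<le> t\<close> by (intro bexI[of _ G]) auto
qed

end
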